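(* Let $r,b,d\ge 1$ be integers, consider the P\'olya urn started with $r$ red and $b$ black balls and with $d$ added balls per draw, let $Z_n$ be the proportion of red balls after the $n$th draw, and let $M_{r,b}=\sup_{n\ge 1} Z_n$. Then: (a) the supremum in the definition of $M_{r,b}$ is almost surely attained (i.e. almost surely there is $n\ge 1$ with $Z_n=M_{r,b}$); (b) $\mathbf{P}(M_{r,b}\text{ is rational})=1$.
   Context: P\'olya's urn with integer parameters $r,b,d\ge 1$: the urn initially contains $r$ red and $b$ black balls. In each draw one ball is taken uniformly at random from the urn, and this ball together with another $d$ balls of the same color is put into the urn. $R_n$ is the number of red balls in the urn after the $n$th draw ($R_0=r$), and $Z_n=R_n/(nd+r+b)$. *)

theory Defs
  imports "HOL-Probability.Probability"
begin

text \<open>A sequence \<open>x :: nat \<Rightarrow> bool\<close> records the outcomes of the draws: \<open>x k\<close> means that the ball taken in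
  the \<open>(k+1)\<close>st draw is red.  Thus \<open>red_balls r d x n\<close> depends only on \<open>x 0, \<dots>, x (n - 1)\<close>.\<close>

primrec red_balls :: "nat \<Rightarrow> nat \<Rightarrow> (nat \<Rightarrow> bool) \<Rightarrow> nat \<Rightarrow> nat" where
  "red_balls r d x 0 = r"
| "red_balls r d x (Suc n) = red_balls r d x n + (if x n then d else 0)"

definition red_proportion :: "nat \<Rightarrow> nat \<Rightarrow> nat \<Rightarrow> (nat \<Rightarrow> bool) \<Rightarrow> nat \<Rightarrow> real" where
  "red_proportion r b d x n = real (red_balls r d x n) / real (n * d + r + b)"

text \<open>The proportions lie in \<open>[0, 1]\<close>, so this is a supremum of a nonempty bounded set of reals.\<close>

definition max_proportion :: "nat \<Rightarrow> nat \<Rightarrow> nat \<Rightarrow> (nat \<Rightarrow> bool) \<Rightarrow> real" where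
  "max_proportion r b d x = (SUP n\<in>{1..}. red_proportion r b d x n)"

text \<open>The urn process lives on an arbitrary probability space.  Given any history of the first \<open>n\<close>
  draws, the next ball is uniform among the \<open>n * d + r + b\<close> balls then in the urn.  As \<open>r\<close> and \<open>b\<close>
  are positive, every finite history has positive probability, so no conditional probability below
  is a division by zero.\<close>

locale polya_urn = prob_space M for M :: "'a measure" +
  fixes r b d :: nat and X :: "nat \<Rightarrow> 'a \<Rightarrow> bool"
  assumes params: "r \<ge> 1" "b \<ge> 1" "d \<ge> 1"
    and random_draw: "\<And>n. random_variable (count_space UNIV) (X n)"
    and prob_red_draw: "\<And>n h. \<P>(\<omega> in M. X n \<omega> \<bar> \<forall>k<n. X k \<omega> = h k)
           = real (red_balls r d h n) / real (n * d + r + b)"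

end

theory Submission
  imports Defs "HOL-Real_Asymp.Real_Asymp"
begin

text \<open>If the proportion of red balls converges to \<open>L\<close> and some \<open>Z\<^sub>n\<close> exceeds \<open>L\<close>, then only finitely many
proportions can compete with \<open>Z\<^sub>n\<close>, so the supremum is a maximum; being one of the \<open>Z\<^sub>n\<close>, it is a quotient
of natural numbers.  Two things thus have to hold almost surely: convergence
(\<open>AE_proportion_tendsto_limit\<close>), and that the limit is exceeded by some \<open>Z\<^sub>n\<close> with \<open>n \<ge> 1\<close>
(\<open>AE_limit_exceeded\<close>).

The second point rests on a bound that is uniform in the contents of the urn: the limit stays below the
initial proportion with probability at least \<open>2 / (75 d)\<close> (\<open>prob_limit_below_start\<close>).  The limit has a
beta distribution, of which only the moments are used.  Its mean is the initial proportion, and its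
kurtosis is at most \<open>15 d\<close> as soon as there is a ball of each colour; a centred variable of bounded kurtosis
is negative with probability bounded away from \<open>0\<close> (\<open>prob_neg_ge_of_fourth_moment\<close>).

After any finite history the urn is again such an urn, with the same \<open>d\<close> (\<open>polya_urn_restart\<close>).  So the event
that some \<open>Z\<^sub>n\<close> exceeds the limit has conditional probability at least \<open>2 / (75 d)\<close> given every
finite history.  The complementary event is determined by the draws and can be approximated by
events that depend on finitely many draws (\<open>algebra_approximates_sigma_sets\<close>); it would be almost equal
to an event in which its own complement has relative probability at least \<open>2 / (75 d)\<close>, which is
impossible unless it is null.  This is the argument behind Levy's zero-one law, without conditional
expectations.\<close>

section \<open>Two facts on finite measures\<close>

text \<open>Integrate the pointwise bound \<open>q(Y) \<le> 1\<close> on \<open>Y < 0\<close>, \<open>q(Y) \<le> 0\<close> elsewhere, for a quartic \<open>q\<close> without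
constant and with negative leading coefficient, so that the expectation of \<open>q(Y)\<close> involves the second and
fourth moments in the right direction.  The double root of \<open>q\<close> at \<open>s > 0\<close> is compensated by the root at \<open>-2 s\<close>
so as to cancel the cubic term, leaving no third moment.\<close>

lemma (in prob_space) prob_neg_ge_of_fourth_moment:
  fixes Y :: "'a \<Rightarrow> real"
  assumes int: "integrable M Y" "integrable M (\<lambda>\<omega>. Y \<omega> ^ 2)" "integrable M (\<lambda>\<omega>. Y \<omega> ^ 4)"
    and mean: "expectation Y = 0"
    and var: "expectation (\<lambda>\<omega>. Y \<omega> ^ 2) = v" "v > 0"
    and fourth: "expectation (\<lambda>\<omega>. Y \<omega> ^ 4) \<le> K * v ^ 2" and K: "K > 0"
  shows "prob {\<omega>\<in>space M. Y \<omega> < 0} \<ge> 2 / (5 * K)"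
proof -
  \<comment> \<open>Any scale with \<open>3 s\<^sup>2 v > K v\<^sup>2\<close> would give a positive bound.\<close>
  define s where "s = sqrt (K * v)"
  have s2: "s ^ 2 = K * v" and s: "s > 0"
    using K var by (auto simp: s_def)
  define q where "q y = - (y * (y - s) ^ 2 * (y + 2 * s)) / (5 * s ^ 4)" for y :: real
  have q_eq: "q y = (3 * s ^ 2 * y ^ 2 - 2 * s ^ 3 * y - y ^ 4) / (5 * s ^ 4)" for y
    unfolding q_def by (rule arg_cong2[where f="(/)"]) (auto simp: algebra_simps eval_nat_numeral)
  have q_le: "q y \<le> indicator {..<0} y" for y
  proof (cases "y < 0")
    case True
    \<comment> \<open>The sum of squares that shows the normalisation \<open>5 s\<^sup>4\<close> to be large enough.\<close>
    have "0 \<le> (y\<^sup>2 - 2 * s\<^sup>2)\<^sup>2 + s\<^sup>2 * (y + s)\<^sup>2"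
      by simp
    also have "\<dots> = 5 * s ^ 4 - (3 * s ^ 2 * y ^ 2 - 2 * s ^ 3 * y - y ^ 4)"
      by (simp add: algebra_simps eval_nat_numeral)
    finally show ?thesis
      using True s by (simp add: q_eq)
  next
    case False
    then have "0 \<le> y * (y - s) ^ 2 * (y + 2 * s)"
      using s by simp
    then show ?thesis
      using False s by (simp add: q_def)
  qed
  have [measurable]: "Y \<in> borel_measurable M"
    using int by auto
  have intq: "integrable M (\<lambda>\<omega>. q (Y \<omega>))"
    unfolding q_eq using int by auto
  have "expectation (\<lambda>\<omega>. q (Y \<omega>)) = (3 * s ^ 2 * v - expectation (\<lambda>\<omega>. Y \<omega> ^ 4)) / (5 * s ^ 4)"
    unfolding q_eq using int mean var by simp
  moreover have "\<dots> \<ge> (3 * s ^ 2 * v - K * v ^ 2) / (5 * s ^ 4)"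
    using fourth by (intro divide_right_mono) auto
  moreover have "s ^ 4 = (K * v) ^ 2"
    using s2 by (simp add: eval_nat_numeral)
  then have "(3 * s ^ 2 * v - K * v ^ 2) / (5 * s ^ 4) = 2 / (5 * K)"
    using K var s2 by (simp add: field_simps power2_eq_square)
  moreover have "expectation (\<lambda>\<omega>. q (Y \<omega>)) \<le> expectation (indicator {\<omega>\<in>space M. Y \<omega> < 0})"
  proof (rule integral_mono[OF intq])
    show "q (Y \<omega>) \<le> indicator {\<omega>\<in>space M. Y \<omega> < 0} \<omega>" if "\<omega> \<in> space M" for \<omega>
      using q_le[of "Y \<omega>"] that by (auto simp: indicator_def)
    show "integrable M (indicat_real {\<omega>\<in>space M. Y \<omega> < 0})"
      by (intro integrable_real_indicator) (auto simp: emeasure_eq_measure)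
  qed
  ultimately show ?thesis
    by simp
qed

text \<open>The approximable sets form a sigma-algebra: complements are approximated by complements, and a countable
union is first cut off to a finite one, whose members are then approximated with errors of total at most
\<open>e / 2\<close>.\<close>

lemma (in finite_measure) algebra_approximates_sigma_sets:
  assumes G: "algebra (space M) G" and sub: "G \<subseteq> sets M"
    and E: "E \<in> sigma_sets (space M) G" and e: "e > 0"
  shows "\<exists>C\<in>G. measure M (sym_diff E C) < e"
  using E e
proof (induction arbitrary: e)
  interpret algebra "space M" G by fact
  case (Compl E)
  then obtain C where C: "C \<in> G" "measure M (sym_diff E C) < e"
    by blast
  have "E \<subseteq> space M" "C \<subseteq> space M"
    using Compl.hyps C sigma_sets_into_sp[OF space_closed] space_closed by auto
  then have "sym_diff (space M - E) (space M - C) = sym_diff E C"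
    by blast
  then show ?case
    using C by (intro bexI[of _ "space M - C"]) auto
next
  interpret algebra "space M" G by fact
  case (Union E)
  have E_sets: "E i \<in> sets M" for i
    using Union.hyps sub sets.sigma_sets_subset by blast
  have "(\<lambda>n. measure M (\<Union>i<n. E i)) \<longlonglongrightarrow> measure M (\<Union>n. \<Union>i<n. E i)"
  proof (rule finite_Lim_measure_incseq)
    show "incseq (\<lambda>n. \<Union>i<n. E i)"
      by (intro monoI UN_mono) auto
  qed (use E_sets in auto)
  also have "(\<Union>n. \<Union>i<n. E i) = (\<Union>i. E i)"
    by auto
  finally have "\<forall>\<^sub>F n in sequentially. measure M (\<Union>i<n. E i) > measure M (\<Union>i. E i) - e / 2"
    by (rule order_tendstoD) (use Union.prems in auto)
  then obtain n where n: "measure M (\<Union>i<n. E i) > measure M (\<Union>i. E i) - e / 2"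
    by (meson eventually_happens' sequentially_bot)
  have "\<forall>i. \<exists>C\<in>G. measure M (sym_diff (E i) C) < e / (2 * real (Suc n))"
    using Union.IH Union.prems by simp
  then obtain C where C: "\<And>i. C i \<in> G" "\<And>i. measure M (sym_diff (E i) (C i)) < e / (2 * real (Suc n))"
    by metis
  have C_sets: "C i \<in> sets M" for i
    using C sub by blast
  let ?C = "\<Union>i<n. C i"
  let ?rest = "(\<Union>i. E i) - (\<Union>i<n. E i)"
  have "measure M (sym_diff (\<Union>i. E i) ?C) \<le> measure M (?rest \<union> (\<Union>i<n. sym_diff (E i) (C i)))"
    by (rule finite_measure_mono) (use E_sets C_sets in auto)
  also have "\<dots> \<le> measure M ?rest + measure M (\<Union>i<n. sym_diff (E i) (C i))"
    by (rule measure_subadditive) (use E_sets C_sets in auto)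
  also have "measure M ?rest = measure M (\<Union>i. E i) - measure M (\<Union>i<n. E i)"
    by (rule finite_measure_Diff) (use E_sets in auto)
  also have "\<dots> < e / 2"
    using n by simp
  also have "measure M (\<Union>i<n. sym_diff (E i) (C i)) \<le> (\<Sum>i<n. measure M (sym_diff (E i) (C i)))"
    by (rule finite_measure_subadditive_finite) (use E_sets C_sets in auto)
  also have "\<dots> \<le> (\<Sum>i<n. e / (2 * real (Suc n)))"
    by (intro sum_mono less_imp_le C)
  also have "\<dots> \<le> e / 2"
    using Union.prems by (simp add: field_simps)
  finally have "measure M (sym_diff (\<Union>i. E i) ?C) < e"
    by simp
  moreover have "?C \<in> G"
    using C by (intro finite_UN) auto
  ultimately show ?case
    by blast
next
  case Empty
  interpret algebra "space M" G by fact
  show ?case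
    using Empty by (intro bexI[of _ "{}"]) auto
qed (auto intro!: bexI)

section \<open>Deterministic facts on sequences\<close>

text \<open>Between consecutive cubes \<open>k\<^sup>3\<close> and \<open>(k + 1)\<^sup>3\<close> there are \<open>O(k\<^sup>2)\<close> steps of size at most \<open>k\<^sup>-\<^sup>3\<close>, so the
sequence moves there by \<open>O(1 / k)\<close> only.\<close>

lemma convergent_of_cubes:
  fixes z :: "nat \<Rightarrow> real"
  assumes step: "\<And>n. \<bar>z (Suc n) - z n\<bar> \<le> 1 / real (Suc n)"
    and cubes: "(\<lambda>k. z (k ^ 3)) \<longlonglongrightarrow> L"
  shows "z \<longlonglongrightarrow> L"
proof -
  have gap: "\<bar>z (m + j) - z m\<bar> \<le> real j / real (Suc m)" for m j
  proof (induction j)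
    case (Suc j)
    have "\<bar>z (Suc (m + j)) - z (m + j)\<bar> \<le> 1 / real (Suc m)"
      by (rule order_trans[OF step]) (simp add: field_simps)
    then show ?case
      using Suc by (simp add: add_divide_distrib)
  qed simp
  define k where "k n = nat \<lfloor>root 3 (real n)\<rfloor>" for n
  have k_lim: "filterlim k at_top sequentially"
    unfolding k_def by real_asymp
  have k: "k n ^ 3 \<le> n" "n < (k n + 1) ^ 3" for n
  proof -
    have "real (k n) \<le> root 3 n" "root 3 n < real (k n) + 1"
      unfolding k_def by simp_all
    then have "real (k n) ^ 3 \<le> root 3 n ^ 3" "root 3 n ^ 3 < (real (k n) + 1) ^ 3"
      by (intro power_mono power_strict_mono; simp)+
    then have "real (k n ^ 3) \<le> real n" "real n < real ((k n + 1) ^ 3)"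
      by (simp_all add: add.commute)
    then show "k n ^ 3 \<le> n" "n < (k n + 1) ^ 3"
      by linarith+
  qed
  have close: "\<bar>z n - z (k n ^ 3)\<bar> \<le> (3 * real (k n) ^ 2 + 3 * real (k n)) / (real (k n) ^ 3 + 1)" for n
  proof -
    have "(k n + 1) ^ 3 = k n ^ 3 + 3 * k n ^ 2 + 3 * k n + 1"
      by (simp add: eval_nat_numeral algebra_simps)
    then have le: "n - k n ^ 3 \<le> 3 * k n ^ 2 + 3 * k n"
      using k(2)[of n] by linarith
    have "real (n - k n ^ 3) \<le> 3 * real (k n) ^ 2 + 3 * real (k n)"
      using of_nat_mono[OF le, where 'a=real] by simp
    moreover have "\<bar>z n - z (k n ^ 3)\<bar> \<le> real (n - k n ^ 3) / real (Suc (k n ^ 3))"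
      using gap[of "k n ^ 3" "n - k n ^ 3"] k(1)[of n] by simp
    ultimately show ?thesis
      by (smt (verit) divide_right_mono of_nat_0_le_iff of_nat_Suc of_nat_power)
  qed
  have "(\<lambda>k. (3 * real k ^ 2 + 3 * real k) / (real k ^ 3 + 1)) \<longlonglongrightarrow> 0"
    by real_asymp
  from filterlim_compose[OF this k_lim] have "(\<lambda>n. z n - z (k n ^ 3)) \<longlonglongrightarrow> 0"
    by (rule Lim_null_comparison[rotated]) (use close in simp)
  from tendsto_add[OF this filterlim_compose[OF cubes k_lim]] show ?thesis
    by simp
qed

lemma SUP_attained_if_limit_exceeded:
  fixes z :: "nat \<Rightarrow> real"
  assumes lim: "z \<longlonglongrightarrow> L" and m: "m \<ge> k" "L < z m"
  shows "\<exists>n\<ge>k. z n = (SUP n\<in>{k..}. z n)"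
proof -
  obtain K where K: "\<And>n. n \<ge> K \<Longrightarrow> z n < z m"
    using order_tendstoD(2)[OF lim m(2)] by (auto simp: eventually_sequentially)
  let ?I = "{k..max m K}"
  have "Max (z ` ?I) \<in> z ` ?I"
    using m by (intro Max_in) auto
  then obtain n where n: "n \<ge> k" "z n = Max (z ` ?I)"
    by auto
  have ub: "z j \<le> z n" if "j \<ge> k" for j
  proof (cases "j \<le> max m K")
    case True
    then show ?thesis
      using that n by simp
  next
    case False
    then have "z j < z m"
      by (intro K) simp
    also have "z m \<le> z n"
      using m n by simp
    finally show ?thesis
      by simp
  qed
  then have "(SUP n\<in>{k..}. z n) = z n"
    using \<open>n \<ge> k\<close> by (intro cSup_eq_maximum) auto
  then show ?thesis
    using n by metis
qed

section \<open>Paths of the urn\<close>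

definition determined_by_first :: "nat \<Rightarrow> ((nat \<Rightarrow> bool) \<Rightarrow> 'b) \<Rightarrow> bool" where
  "determined_by_first n F \<longleftrightarrow> (\<forall>x y. (\<forall>k<n. x k = y k) \<longrightarrow> F x = F y)"

lemma determined_by_firstD: "determined_by_first n F \<Longrightarrow> (\<And>k. k < n \<Longrightarrow> x k = y k) \<Longrightarrow> F x = F y"
  by (auto simp: determined_by_first_def)

lemma determined_by_first_mono: "determined_by_first m F \<Longrightarrow> m \<le> n \<Longrightarrow> determined_by_first n F"
  by (subst determined_by_first_def) (auto elim!: determined_by_firstD)

lemma determined_by_first_mult:
  fixes F G :: "(nat \<Rightarrow> bool) \<Rightarrow> real"
  assumes "determined_by_first n F" "determined_by_first n G"
  shows "determined_by_first n (\<lambda>x. F x * G x)"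
  using assms unfolding determined_by_first_def by metis

lemma determined_by_first_diff:
  fixes F G :: "(nat \<Rightarrow> bool) \<Rightarrow> real"
  assumes "determined_by_first n F" "determined_by_first n G"
  shows "determined_by_first n (\<lambda>x. F x - G x)"
  using assms unfolding determined_by_first_def by metis

lemma determined_by_first_nth: "k < n \<Longrightarrow> determined_by_first n (\<lambda>x. f (x k))"
  unfolding determined_by_first_def by presburger

lemma red_balls_determined:
  assumes "n \<le> m"
  shows "determined_by_first m (\<lambda>x. f (red_balls r d x n))"
proof -
  have "red_balls r d x n = red_balls r d y n" if "\<forall>k<n. x k = y k" for x y
    using that by (induction n) auto
  then have "determined_by_first n (\<lambda>x. f (red_balls r d x n))"
    unfolding determined_by_first_def by metis
  then show ?thesis
    using assms by (rule determined_by_first_mono)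
qed

lemma red_proportion_determined:
  "n \<le> m \<Longrightarrow> determined_by_first m (\<lambda>x. red_proportion r b d x n)"
  unfolding red_proportion_def by (rule red_balls_determined)

lemma red_balls_bounds: "r \<le> red_balls r d x n" "red_balls r d x n \<le> n * d + r"
  by (induction n) auto

lemma red_proportion_bounds: "0 \<le> red_proportion r b d x n" "red_proportion r b d x n \<le> 1"
  using red_balls_bounds(2)[of r d x n] by (auto simp: red_proportion_def divide_le_eq_1 simp flip: of_nat_add of_nat_mult)

lemma red_balls_shift:
  "red_balls r d x (n + m) = red_balls (red_balls r d x n) d (\<lambda>k. x (n + k)) m"
  by (induction m) auto

lemma red_proportion_shift:
  "red_proportion r b d x (n + m) =
     red_proportion (red_balls r d x n) (n * d + r + b - red_balls r d x n) d (\<lambda>k. x (n + k)) m"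
proof -
  have "(n + m) * d + r + b = m * d + red_balls r d x n + (n * d + r + b - red_balls r d x n)"
    using red_balls_bounds(2)[of r d x n] by (simp add: algebra_simps)
  then show ?thesis
    by (simp only: red_proportion_def red_balls_shift)
qed

lemma red_proportion_step:
  assumes "r + b > 0"
  shows "\<bar>red_proportion r b d x (Suc n) - red_proportion r b d x n\<bar> \<le> 1 / real (Suc n)"
proof -
  define N where "N = real (n * d + r + b)"
  define R where "R = real (red_balls r d x n)"
  have N: "N > 0" "0 \<le> R" "R \<le> N" "real n * real d \<le> N"
    using assms red_balls_bounds[where r=r and n=n and d=d and x=x]
    by (auto simp: N_def R_def simp flip: of_nat_add of_nat_mult)
  have "red_proportion r b d x (Suc n) - red_proportion r b d x n
          = (R + (if x n then d else 0)) / (N + d) - R / N"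
    by (simp add: red_proportion_def R_def N_def algebra_simps)
  also have "\<dots> = d * ((if x n then N else 0) - R) / (N * (N + d))"
    using N by (simp add: field_simps)
  also have "\<bar>\<dots>\<bar> = d * \<bar>(if x n then N else 0) - R\<bar> / (N * (N + d))"
    using N by (simp add: abs_mult)
  also have "\<dots> \<le> d * N / (N * (N + d))"
    using N by (intro divide_right_mono mult_left_mono) auto
  also have "\<dots> = d / (N + d)"
    using N by simp
  also have "\<dots> \<le> 1 / real (Suc n)"
    using N by (simp add: field_simps)
  finally show ?thesis .
qed

text \<open>The moments of a beta distribution are quotients of rising factorials; with step \<open>d\<close> these are directly in
terms of numbers of balls.\<close>

definition rising :: "real \<Rightarrow> nat \<Rightarrow> real \<Rightarrow> real" where
  "rising d k a = (\<Prod>i<k. a + real i * d)"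

lemma rising_shift: "a * rising d k (a + d) = rising d k a * (a + real k * d)"
proof -
  have "a * rising d k (a + d) = (\<Prod>i<Suc k. a + real i * d)"
    unfolding prod.lessThan_Suc_shift by (simp add: rising_def algebra_simps)
  then show ?thesis
    by (simp add: rising_def)
qed

lemma rising_pos: "a > 0 \<Longrightarrow> d \<ge> 0 \<Longrightarrow> rising d k a > 0"
  unfolding rising_def by (intro prod_pos) (auto intro: add_pos_nonneg)

text \<open>This is the one-step martingale property of the quotient of rising factorials: with \<open>a\<close> red balls among \<open>N\<close>, the
next draw changes \<open>a\<close> into \<open>a + d\<close> with probability \<open>a / N\<close>, and \<open>N\<close> into \<open>N + d\<close>.\<close>

lemma rising_ratio_step:
  assumes "N > 0" "d \<ge> 0"
  shows "rising d k a / rising d k (N + d) + (rising d k (a + d) / rising d k (N + d) - rising d k a / rising d k (N + d)) * (a / N)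
           = rising d k a / rising d k N"
proof -
  have pos: "rising d k N > 0" "rising d k (N + d) > 0" "N + real k * d > 0"
    using assms by (auto intro: rising_pos add_pos_nonneg)
  have "rising d k a / rising d k (N + d) + (rising d k (a + d) / rising d k (N + d) - rising d k a / rising d k (N + d)) * (a / N)
        = ((N - a) * rising d k a + a * rising d k (a + d)) / (N * rising d k (N + d))"
    using assms pos by (simp add: field_simps)
  also have "(N - a) * rising d k a + a * rising d k (a + d) = rising d k a * (N + real k * d)"
    unfolding rising_shift by (simp add: algebra_simps)
  also have "N * rising d k (N + d) = rising d k N * (N + real k * d)"
    by (rule rising_shift)
  finally show ?thesis
    using pos by simp
qed

section \<open>Averaging over histories\<close>

context polya_urn
begin

declare random_draw [measurable]

definition history :: "nat \<Rightarrow> (nat \<Rightarrow> bool) \<Rightarrow> 'a set" where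
  "history n h = {\<omega>\<in>space M. \<forall>k<n. X k \<omega> = h k}"

lemma history_measurable [measurable]: "history n h \<in> sets M"
  unfolding history_def by measurable

lemma prob_history_Int_red:
  "prob (history n h \<inter> {\<omega>\<in>space M. X n \<omega>}) = prob (history n h) * red_proportion r b d h n"
proof (cases "prob (history n h) = 0")
  case True
  have "prob (history n h \<inter> {\<omega>\<in>space M. X n \<omega>}) \<le> prob (history n h)"
    by (rule finite_measure_mono) auto
  then show ?thesis
    using True measure_nonneg[of M "history n h \<inter> {\<omega>\<in>space M. X n \<omega>}"] by simp
next
  case False
  have "{\<omega>\<in>space M. X n \<omega> \<and> (\<forall>k<n. X k \<omega> = h k)} = history n h \<inter> {\<omega>\<in>space M. X n \<omega>}"
    by (auto simp: history_def)
  then have "prob (history n h \<inter> {\<omega>\<in>space M. X n \<omega>}) / prob (history n h) = red_proportion r b d h n"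
    using prob_red_draw[of n h] by (simp add: cond_prob_def red_proportion_def history_def)
  with False show ?thesis
    by (simp add: field_simps)
qed

text \<open>Both colours are present at all times, so each next outcome has positive conditional probability.  This is
what allows conditioning on a history below.\<close>

lemma prob_history_pos: "prob (history n h) > 0"
proof (induction n)
  case 0
  then show ?case
    by (simp add: history_def prob_space)
next
  case (Suc n)
  have R: "0 < red_balls r d h n" "red_balls r d h n < n * d + r + b"
    using red_balls_bounds[of r d h n] params by linarith+
  then have Z: "0 < red_proportion r b d h n" "red_proportion r b d h n < 1"
    unfolding red_proportion_def using less_trans[OF R] by (simp_all del: of_nat_add of_nat_mult)
  show ?case
  proof (cases "h n")
    case True
    then have "history (Suc n) h = history n h \<inter> {\<omega>\<in>space M. X n \<omega>}"
      by (auto simp: history_def less_Suc_eq)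
    then show ?thesis
      using Suc Z by (simp add: prob_history_Int_red)
  next
    case False
    then have "history (Suc n) h = history n h - history n h \<inter> {\<omega>\<in>space M. X n \<omega>}"
      by (auto simp: history_def less_Suc_eq)
    then have "prob (history (Suc n) h) = prob (history n h) * (1 - red_proportion r b d h n)"
      by (simp add: finite_measure_Diff prob_history_Int_red algebra_simps)
    then show ?thesis
      using Suc Z by simp
  qed
qed

text \<open>A function of the first \<open>n\<close> outcomes is a simple function; the histories of length \<open>n\<close> are indexed by the
set of times at which red is drawn.\<close>

lemma sum_over_histories:
  fixes F :: "(nat \<Rightarrow> bool) \<Rightarrow> real"
  assumes F: "determined_by_first n F" and \<omega>: "\<omega> \<in> space M"
  shows "F (\<lambda>k. X k \<omega>) = (\<Sum>S\<in>Pow {..<n}. F (\<lambda>k. k \<in> S) * indicator (history n (\<lambda>k. k \<in> S)) \<omega>)"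
proof -
  define S where "S = {k. k < n \<and> X k \<omega>}"
  have "indicator (history n (\<lambda>k. k \<in> T)) \<omega> = (if T = S then 1 else 0 :: real)" if "T \<in> Pow {..<n}" for T
    using that \<omega> by (auto simp: indicator_def history_def S_def)
  then have "(\<Sum>T\<in>Pow {..<n}. F (\<lambda>k. k \<in> T) * indicator (history n (\<lambda>k. k \<in> T)) \<omega>)
             = (\<Sum>T\<in>Pow {..<n}. if T = S then F (\<lambda>k. k \<in> T) else 0)"
    by (intro sum.cong) auto
  also have "\<dots> = F (\<lambda>k. k \<in> S)"
    by (subst sum.delta) (auto simp: S_def)
  also have "\<dots> = F (\<lambda>k. X k \<omega>)"
    by (rule determined_by_firstD[OF F]) (simp add: S_def)
  finally show ?thesis ..
qed

lemma integrable_determined: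
  fixes F :: "(nat \<Rightarrow> bool) \<Rightarrow> real"
  assumes "determined_by_first n F"
  shows "integrable M (\<lambda>\<omega>. F (\<lambda>k. X k \<omega>))"
proof -
  have "integrable M (\<lambda>\<omega>. \<Sum>S\<in>Pow {..<n}. F (\<lambda>k. k \<in> S) * indicator (history n (\<lambda>k. k \<in> S)) \<omega>)"
    by (intro Bochner_Integration.integrable_sum integrable_mult_right integrable_real_indicator)
       (auto simp: emeasure_eq_measure)
  then show ?thesis
    by (rule Bochner_Integration.integrable_cong[THEN iffD1, rotated 2])
       (auto simp only: sum_over_histories[OF assms])
qed

text \<open>On each history, the indicator of a red draw averages to its conditional probability.  Both martingale
properties below come from this rule.\<close>

lemma expectation_red_draw:
  fixes F :: "(nat \<Rightarrow> bool) \<Rightarrow> real"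
  assumes F: "determined_by_first n F"
  shows "expectation (\<lambda>\<omega>. F (\<lambda>k. X k \<omega>) * of_bool (X n \<omega>))
           = expectation (\<lambda>\<omega>. F (\<lambda>k. X k \<omega>) * red_proportion r b d (\<lambda>k. X k \<omega>) n)"
proof -
  let ?H = "\<lambda>S. history n (\<lambda>k. k \<in> S)" and ?red = "{\<omega>\<in>space M. X n \<omega>}"
  have "expectation (\<lambda>\<omega>. F (\<lambda>k. X k \<omega>) * of_bool (X n \<omega>))
        = expectation (\<lambda>\<omega>. \<Sum>S\<in>Pow {..<n}. F (\<lambda>k. k \<in> S) * indicator (?H S \<inter> ?red) \<omega>)"
    by (intro Bochner_Integration.integral_cong refl, subst sum_over_histories[OF F])
       (auto simp: sum_distrib_right indicator_def intro!: sum.cong)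
  also have "\<dots> = (\<Sum>S\<in>Pow {..<n}. F (\<lambda>k. k \<in> S) * prob (?H S \<inter> ?red))"
    by (subst Bochner_Integration.integral_sum) (auto simp: emeasure_eq_measure)
  also have "\<dots> = (\<Sum>S\<in>Pow {..<n}. F (\<lambda>k. k \<in> S) * red_proportion r b d (\<lambda>k. k \<in> S) n * prob (?H S))"
    by (simp add: prob_history_Int_red mult_ac)
  also have "\<dots> = expectation (\<lambda>\<omega>. \<Sum>S\<in>Pow {..<n}.
                     F (\<lambda>k. k \<in> S) * red_proportion r b d (\<lambda>k. k \<in> S) n * indicator (?H S) \<omega>)"
    by (subst Bochner_Integration.integral_sum) (auto simp: emeasure_eq_measure)
  also have "\<dots> = expectation (\<lambda>\<omega>. F (\<lambda>k. X k \<omega>) * red_proportion r b d (\<lambda>k. X k \<omega>) n)"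
  proof (intro Bochner_Integration.integral_cong refl, subst sum_over_histories[symmetric])
    show "determined_by_first n (\<lambda>x. F x * red_proportion r b d x n)"
      by (intro determined_by_first_mult F red_proportion_determined order_refl)
  qed auto
  finally show ?thesis .
qed

lemma expectation_martingale:
  fixes F :: "(nat \<Rightarrow> bool) \<Rightarrow> real"
  assumes F: "determined_by_first n F"
  shows "expectation (\<lambda>\<omega>. F (\<lambda>k. X k \<omega>) *
           (red_proportion r b d (\<lambda>k. X k \<omega>) (Suc n) - red_proportion r b d (\<lambda>k. X k \<omega>) n)) = 0"
proof -
  define N where "N = real (n * d + r + b)"
  have N: "N > 0" "N + d > 0"
    using params by (auto simp: N_def intro: add_nonneg_pos)
  let ?Z = "\<lambda>\<omega>. red_proportion r b d (\<lambda>k. X k \<omega>) n" and ?F = "\<lambda>\<omega>. F (\<lambda>k. X k \<omega>)"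
  have step: "red_proportion r b d x (Suc n) - red_proportion r b d x n
          = d / (N + d) * (of_bool (x n) - red_proportion r b d x n)" for x
  proof -
    have "red_proportion r b d x (Suc n) = (real (red_balls r d x n) + d * of_bool (x n)) / (N + d)"
      by (simp add: red_proportion_def N_def algebra_simps)
    moreover have "real (red_balls r d x n) = red_proportion r b d x n * N"
      using N by (simp add: red_proportion_def N_def)
    ultimately show ?thesis
      using N by (simp add: field_simps)
  qed
  have "determined_by_first (Suc n) (\<lambda>x. F x * of_bool (x n))"
    by (intro determined_by_first_mult determined_by_first_mono[OF F] determined_by_first_nth) auto
  then have i1: "integrable M (\<lambda>\<omega>. ?F \<omega> * of_bool (X n \<omega>))"
    by (rule integrable_determined)
  have "determined_by_first n (\<lambda>x. F x * red_proportion r b d x n)"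
    by (intro determined_by_first_mult F red_proportion_determined order_refl)
  then have i2: "integrable M (\<lambda>\<omega>. ?F \<omega> * ?Z \<omega>)"
    by (rule integrable_determined)
  have "expectation (\<lambda>\<omega>. ?F \<omega> * (red_proportion r b d (\<lambda>k. X k \<omega>) (Suc n) - ?Z \<omega>))
        = expectation (\<lambda>\<omega>. d / (N + d) * (?F \<omega> * of_bool (X n \<omega>) - ?F \<omega> * ?Z \<omega>))"
    by (simp add: step algebra_simps)
  also have "\<dots> = d / (N + d) * (expectation (\<lambda>\<omega>. ?F \<omega> * of_bool (X n \<omega>)) - expectation (\<lambda>\<omega>. ?F \<omega> * ?Z \<omega>))"
    using i1 i2 by simp
  also have "\<dots> = 0"
    by (simp add: expectation_red_draw[OF F])
  finally show ?thesis .
qed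

text \<open>Since the right-hand side does not depend on \<open>n\<close>, it survives the passage to the limit, where the quotient of
rising factorials becomes the \<open>k\<close>-th power of the limiting proportion.\<close>

lemma expectation_rising:
  "expectation (\<lambda>\<omega>. rising d k (red_balls r d (\<lambda>k. X k \<omega>) n) / rising d k (n * d + r + b))
     = rising d k r / rising d k (real r + real b)"
proof (induction n)
  case 0
  then show ?case
    by (simp add: prob_space)
next
  case (Suc n)
  define N where "N = real (n * d + r + b)"
  have N: "N > 0" and Suc_N: "real (Suc n * d + r + b) = N + d"
    using params by (auto simp: N_def intro: add_nonneg_pos)
  let ?R = "\<lambda>\<omega>. real (red_balls r d (\<lambda>k. X k \<omega>) n)"
  define f where "f a = rising d k a / rising d k (N + d)" for a
  have det: "determined_by_first n (\<lambda>x. g (red_balls r d x n))" for g :: "nat \<Rightarrow> real"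
    by (rule red_balls_determined) simp
  have i1: "integrable M (\<lambda>\<omega>. g (red_balls r d (\<lambda>k. X k \<omega>) n))" for g :: "nat \<Rightarrow> real"
    by (rule integrable_determined[OF det])
  have "determined_by_first (Suc n) (\<lambda>x. (\<lambda>a. f (real a + d) - f a) (red_balls r d x n) * of_bool (x n))"
    by (intro determined_by_first_mult red_balls_determined determined_by_first_nth) auto
  from integrable_determined[OF this]
  have i2: "integrable M (\<lambda>\<omega>. (f (?R \<omega> + d) - f (?R \<omega>)) * of_bool (X n \<omega>))"
    by simp
  have "expectation (\<lambda>\<omega>. f (red_balls r d (\<lambda>k. X k \<omega>) (Suc n)))
        = expectation (\<lambda>\<omega>. f (?R \<omega>) + (f (?R \<omega> + d) - f (?R \<omega>)) * of_bool (X n \<omega>))"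
    by (intro Bochner_Integration.integral_cong) auto
  also have "\<dots> = expectation (\<lambda>\<omega>. f (?R \<omega>)) + expectation (\<lambda>\<omega>. (f (?R \<omega> + d) - f (?R \<omega>)) * of_bool (X n \<omega>))"
    by (rule Bochner_Integration.integral_add[OF i1 i2])
  also have "expectation (\<lambda>\<omega>. (f (?R \<omega> + d) - f (?R \<omega>)) * of_bool (X n \<omega>))
             = expectation (\<lambda>\<omega>. (f (?R \<omega> + d) - f (?R \<omega>)) * (?R \<omega> / N))"
    using expectation_red_draw[OF det[of "\<lambda>a. f (real a + d) - f a"]] by (simp add: red_proportion_def N_def)
  also have "expectation (\<lambda>\<omega>. f (?R \<omega>)) + \<dots> = expectation (\<lambda>\<omega>. f (?R \<omega>) + (f (?R \<omega> + d) - f (?R \<omega>)) * (?R \<omega> / N))"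
    by (rule Bochner_Integration.integral_add[symmetric]) (rule i1)+
  also have "\<dots> = expectation (\<lambda>\<omega>. rising d k (?R \<omega>) / rising d k N)"
    unfolding f_def by (subst rising_ratio_step[OF N]) auto
  finally show ?case
    using Suc by (simp only: Suc_N f_def N_def)
qed

end

section \<open>Almost sure convergence of the proportions\<close>

text \<open>The measure space is left general because the limit is also studied on the sigma-algebra generated by
finitely determined events.\<close>

lemma red_proportion_measurable:
  assumes [measurable]: "\<And>k. X k \<in> measurable N (count_space UNIV)"
  shows "(\<lambda>\<omega>. red_proportion r b d (\<lambda>k. X k \<omega>) n) \<in> borel_measurable N"
proof -
  have "(\<lambda>\<omega>. real (red_balls r d (\<lambda>k. X k \<omega>) n)) \<in> borel_measurable N"
  proof (induction n)
    case (Suc n)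
    note [measurable] = Suc
    have "(\<lambda>\<omega>. real (red_balls r d (\<lambda>k. X k \<omega>) n) + (if X n \<omega> then real d else 0)) \<in> borel_measurable N"
      by measurable
    then show ?case
      by (simp add: if_distrib cong: if_cong)
  qed simp
  then show ?thesis
    unfolding red_proportion_def by measurable
qed

definition limit_proportion :: "nat \<Rightarrow> nat \<Rightarrow> nat \<Rightarrow> (nat \<Rightarrow> bool) \<Rightarrow> real" where
  "limit_proportion r b d x = lim (red_proportion r b d x)"

lemma limit_proportion_measurable:
  assumes "\<And>k. X k \<in> measurable N (count_space UNIV)"
  shows "(\<lambda>\<omega>. limit_proportion r b d (\<lambda>k. X k \<omega>)) \<in> borel_measurable N"
  unfolding limit_proportion_def by (intro borel_measurable_lim_metric red_proportion_measurable assms)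

lemma limit_proportion_shift:
  "limit_proportion (red_balls r d x n) (n * d + r + b - red_balls r d x n) d (\<lambda>k. x (n + k))
     = limit_proportion r b d x"
proof -
  have "((\<lambda>m. red_proportion r b d x (n + m)) \<longlonglongrightarrow> L) \<longleftrightarrow> red_proportion r b d x \<longlonglongrightarrow> L" for L
    using LIMSEQ_offset[of "red_proportion r b d x" n] LIMSEQ_ignore_initial_segment[of "red_proportion r b d x" L n]
    by (auto simp: add.commute)
  moreover have "red_proportion (red_balls r d x n) (n * d + r + b - red_balls r d x n) d (\<lambda>k. x (n + k))
      = (\<lambda>m. red_proportion r b d x (n + m))"
    by (simp add: fun_eq_iff red_proportion_shift)
  ultimately show ?thesis
    by (simp only: limit_proportion_def lim_def)
qed

context polya_urn
begin

declare red_proportion_measurable[OF random_draw, measurable]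
declare limit_proportion_measurable[OF random_draw, measurable]

text \<open>Martingale increments are orthogonal, and the increment at step \<open>n\<close> is at most \<open>1 / (n + 1)\<close>.\<close>

lemma expectation_increment_square_le:
  "expectation (\<lambda>\<omega>. (red_proportion r b d (\<lambda>k. X k \<omega>) (m + j) - red_proportion r b d (\<lambda>k. X k \<omega>) m) ^ 2)
     \<le> real j / real (Suc m) ^ 2"
proof (induction j)
  case 0
  then show ?case
    by simp
next
  case (Suc j)
  let ?Z = "\<lambda>n x. red_proportion r b d x n"
  let ?P = "\<lambda>\<omega> k. X k \<omega>"
  define A where "A x = ?Z (m + j) x - ?Z m x" for x
  define D where "D x = ?Z (Suc (m + j)) x - ?Z (m + j) x" for x
  have det: "determined_by_first (m + j) A" "determined_by_first (Suc (m + j)) A"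
      "determined_by_first (Suc (m + j)) D"
    unfolding A_def D_def using red_proportion_determined[of _ "m + j" r b d]
      red_proportion_determined[of _ "Suc (m + j)" r b d]
    by (auto intro!: determined_by_first_diff)
  have int: "integrable M (\<lambda>\<omega>. A (?P \<omega>) * A (?P \<omega>))" "integrable M (\<lambda>\<omega>. A (?P \<omega>) * D (?P \<omega>))"
      "integrable M (\<lambda>\<omega>. D (?P \<omega>) * D (?P \<omega>))"
    by (intro integrable_determined[of "Suc (m + j)"] determined_by_first_mult det)+
  have "?Z (m + Suc j) x - ?Z m x = A x + D x" for x
    by (simp add: A_def D_def)
  then have "expectation (\<lambda>\<omega>. (?Z (m + Suc j) (?P \<omega>) - ?Z m (?P \<omega>)) ^ 2)
     = expectation (\<lambda>\<omega>. A (?P \<omega>) * A (?P \<omega>) + 2 * (A (?P \<omega>) * D (?P \<omega>)) + D (?P \<omega>) * D (?P \<omega>))"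
    by (simp add: power2_eq_square algebra_simps)
  also have "\<dots> = expectation (\<lambda>\<omega>. A (?P \<omega>) * A (?P \<omega>)) + 2 * expectation (\<lambda>\<omega>. A (?P \<omega>) * D (?P \<omega>))
                  + expectation (\<lambda>\<omega>. D (?P \<omega>) * D (?P \<omega>))"
    using int by simp
  also have "expectation (\<lambda>\<omega>. A (?P \<omega>) * D (?P \<omega>)) = 0"
    unfolding D_def by (rule expectation_martingale[OF det(1)])
  also have "expectation (\<lambda>\<omega>. A (?P \<omega>) * A (?P \<omega>)) \<le> real j / real (Suc m) ^ 2"
    using Suc by (simp add: A_def power2_eq_square)
  also have "expectation (\<lambda>\<omega>. D (?P \<omega>) * D (?P \<omega>)) \<le> expectation (\<lambda>\<omega>. 1 / real (Suc m) ^ 2)"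
  proof (rule integral_mono[OF int(3)])
    fix \<omega>
    have "\<bar>D (?P \<omega>)\<bar> \<le> 1 / real (Suc (m + j))"
      unfolding D_def using params by (intro red_proportion_step) auto
    also have "\<dots> \<le> 1 / real (Suc m)"
      by (simp add: field_simps)
    finally have "\<bar>D (?P \<omega>)\<bar> ^ 2 \<le> (1 / real (Suc m)) ^ 2"
      by (intro power_mono) auto
    then show "D (?P \<omega>) * D (?P \<omega>) \<le> 1 / real (Suc m) ^ 2"
      by (simp add: power2_eq_square)
  qed simp
  finally show ?case
    by (simp add: prob_space add_divide_distrib)
qed

text \<open>Let \<open>D\<^sub>k\<close> be the increment of the proportions from time \<open>k\<^sup>3\<close> to \<open>(k + 1)\<^sup>3\<close>.  Its second moment is \<open>O(k\<^sup>-\<^sup>4)\<close>, so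
\<open>k\<^sup>2 D\<^sub>k\<^sup>2\<close> has a finite expected sum and is almost surely summable.  Since
\<open>\<bar>D\<^sub>k\<bar> \<le> k\<^sup>2 D\<^sub>k\<^sup>2 + k\<^sup>-\<^sup>2\<close>, the proportions converge along the cubes, hence along all times.\<close>

lemma AE_proportion_tendsto_limit:
  "AE \<omega> in M. red_proportion r b d (\<lambda>k. X k \<omega>) \<longlonglongrightarrow> limit_proportion r b d (\<lambda>k. X k \<omega>)"
proof -
  let ?Z = "\<lambda>n \<omega>. red_proportion r b d (\<lambda>k. X k \<omega>) n"
  define D where "D k \<omega> = ?Z (Suc k ^ 3) \<omega> - ?Z (k ^ 3) \<omega>" for k \<omega>
  define w where "w k = real k ^ 2" for k
  have [measurable]: "D k \<in> borel_measurable M" for k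
    unfolding D_def by measurable
  have D_bound: "\<bar>D k \<omega>\<bar> \<le> 1" for k \<omega>
    using red_proportion_bounds[of r b d "\<lambda>k. X k \<omega>" "Suc k ^ 3"]
      red_proportion_bounds[of r b d "\<lambda>k. X k \<omega>" "k ^ 3"] by (auto simp: D_def)
  have int: "integrable M (\<lambda>\<omega>. w k * D k \<omega> ^ 2)" for k
    by (rule integrable_const_bound[where B="w k"])
       (use D_bound in \<open>auto simp: w_def abs_mult abs_square_le_1 power_le_one_iff mult_left_le\<close>)
  have le: "expectation (\<lambda>\<omega>. w k * D k \<omega> ^ 2) \<le> w k * ((3 * real k ^ 2 + 3 * real k + 1) / (real k ^ 3 + 1) ^ 2)" for k
  proof -
    have "Suc k ^ 3 = k ^ 3 + (3 * k ^ 2 + 3 * k + 1)"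
      by (simp add: eval_nat_numeral algebra_simps)
    then have "expectation (\<lambda>\<omega>. D k \<omega> ^ 2) \<le> (3 * real k ^ 2 + 3 * real k + 1) / (real k ^ 3 + 1) ^ 2"
      using expectation_increment_square_le[of "k ^ 3" "3 * k ^ 2 + 3 * k + 1"]
      by (simp add: D_def add.commute)
    then show ?thesis
      unfolding w_def by (simp del: times_divide_eq_right add: mult_left_mono)
  qed
  have "summable (\<lambda>k. w k * ((3 * real k ^ 2 + 3 * real k + 1) / (real k ^ 3 + 1) ^ 2))"
  proof (rule summable_comparison_test_bigo)
    show "summable (\<lambda>k. norm (1 / real k ^ 2))"
      using inverse_power_summable[of 2, where 'a=real] by (simp add: field_simps)
    show "(\<lambda>k. w k * ((3 * real k ^ 2 + 3 * real k + 1) / (real k ^ 3 + 1) ^ 2)) \<in> O(\<lambda>k. 1 / real k ^ 2)"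
      unfolding w_def by real_asymp
  qed
  then have summ: "summable (\<lambda>k. expectation (\<lambda>\<omega>. w k * D k \<omega> ^ 2))"
    by (rule summable_comparison_test'[where N=0]) (use le in \<open>auto simp: w_def integral_nonneg\<close>)
  have "(\<integral>\<^sup>+\<omega>. (\<Sum>k. ennreal (w k * D k \<omega> ^ 2)) \<partial>M) = (\<Sum>k. \<integral>\<^sup>+\<omega>. ennreal (w k * D k \<omega> ^ 2) \<partial>M)"
    by (rule nn_integral_suminf) measurable
  also have "\<dots> = (\<Sum>k. ennreal (expectation (\<lambda>\<omega>. w k * D k \<omega> ^ 2)))"
    by (intro suminf_cong nn_integral_eq_integral int) (auto simp: w_def)
  also have "\<dots> = ennreal (\<Sum>k. expectation (\<lambda>\<omega>. w k * D k \<omega> ^ 2))"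
    by (rule suminf_ennreal2[OF _ summ]) (auto simp: w_def)
  finally have "(\<integral>\<^sup>+\<omega>. (\<Sum>k. ennreal (w k * D k \<omega> ^ 2)) \<partial>M) \<noteq> \<infinity>"
    by simp
  then have "AE \<omega> in M. (\<Sum>k. ennreal (w k * D k \<omega> ^ 2)) \<noteq> \<infinity>"
    by (rule nn_integral_noteq_infinite[rotated]) measurable
  then show ?thesis
  proof (rule AE_mp, intro AE_I2 impI)
    fix \<omega>
    assume "(\<Sum>k. ennreal (w k * D k \<omega> ^ 2)) \<noteq> \<infinity>"
    then have "summable (\<lambda>k. w k * D k \<omega> ^ 2)"
      by (intro summable_suminf_not_top) (auto simp: w_def)
    moreover have "summable (\<lambda>k. 1 / w k)"
      using inverse_power_summable[of 2, where 'a=real] by (simp add: field_simps w_def)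
    ultimately have "summable (\<lambda>k. w k * D k \<omega> ^ 2 + 1 / w k)"
      by (rule summable_add)
    then have "summable (\<lambda>k. D k \<omega>)"
    proof (rule summable_comparison_test'[where N=1])
      fix k :: nat
      assume "1 \<le> k"
      then have w: "w k > 0"
        by (simp add: w_def)
      have "0 \<le> (w k * \<bar>D k \<omega>\<bar> - 1) ^ 2 + w k * \<bar>D k \<omega>\<bar>"
        using w by simp
      also have "\<dots> = w k * (w k * D k \<omega> ^ 2 + 1 / w k - \<bar>D k \<omega>\<bar>)"
        using w by (simp add: power2_eq_square algebra_simps flip: abs_mult)
      finally show "norm (D k \<omega>) \<le> w k * D k \<omega> ^ 2 + 1 / w k"
        using w by (simp add: zero_le_mult_iff)
    qed
    then obtain s where "(\<lambda>k. D k \<omega>) sums s"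
      by (auto simp: summable_def)
    then have "(\<lambda>n. ?Z 0 \<omega> + (\<Sum>k<n. D k \<omega>)) \<longlonglongrightarrow> ?Z 0 \<omega> + s"
      unfolding sums_def by (intro tendsto_add tendsto_const)
    moreover have "?Z 0 \<omega> + (\<Sum>k<n. D k \<omega>) = ?Z (n ^ 3) \<omega>" for n
      unfolding D_def by (subst sum_lessThan_telescope[of "\<lambda>k. ?Z (k ^ 3) \<omega>"]) simp
    ultimately have "(\<lambda>n. ?Z (n ^ 3) \<omega>) \<longlonglongrightarrow> ?Z 0 \<omega> + s"
      by simp
    then have "(\<lambda>n. ?Z n \<omega>) \<longlonglongrightarrow> ?Z 0 \<omega> + s"
      by (rule convergent_of_cubes[rotated]) (use params in \<open>intro red_proportion_step; simp\<close>)
    then show "red_proportion r b d (\<lambda>k. X k \<omega>) \<longlonglongrightarrow> limit_proportion r b d (\<lambda>k. X k \<omega>)"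
      unfolding limit_proportion_def by (metis limI)
  qed
qed

lemma limit_proportion_bounds:
  "AE \<omega> in M. \<bar>limit_proportion r b d (\<lambda>k. X k \<omega>)\<bar> \<le> 1"
  using AE_proportion_tendsto_limit
proof eventually_elim
  case (elim \<omega>)
  then show ?case
    using LIMSEQ_le_const2[OF elim, of 1] LIMSEQ_le_const[OF elim, of 0] red_proportion_bounds
    by auto
qed

text \<open>Each factor \<open>(R\<^sub>n + i d) / (N\<^sub>n + i d)\<close> of the constant rising moment has the same limit as the proportion, and all
are bounded by \<open>1\<close>, so dominated convergence applies.\<close>

lemma expectation_limit_power:
  "expectation (\<lambda>\<omega>. limit_proportion r b d (\<lambda>k. X k \<omega>) ^ k) = rising d k r / rising d k (real r + real b)"
proof -
  let ?R = "\<lambda>n \<omega>. real (red_balls r d (\<lambda>k. X k \<omega>) n)"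
  let ?N = "\<lambda>n. real (n * d + r + b)"
  let ?L = "\<lambda>\<omega>. limit_proportion r b d (\<lambda>k. X k \<omega>)"
  define g where "g n \<omega> = rising d k (?R n \<omega>) / rising d k (?N n)" for n \<omega>
  have g_eq: "g n \<omega> = (\<Prod>i<k. (?R n \<omega> + real i * d) / (?N n + real i * d))" for n \<omega>
    by (simp add: g_def rising_def prod_dividef)
  have N_pos: "?N n > 0" for n
    using params by (auto intro: add_nonneg_pos)
  have R_le: "?R n \<omega> \<le> ?N n" for n \<omega>
    using red_balls_bounds(2)[of r d "\<lambda>k. X k \<omega>" n] by (simp flip: of_nat_add of_nat_mult)
  have g_bound: "norm (g n \<omega>) \<le> 1" for n \<omega>
  proof -
    have "0 \<le> (?R n \<omega> + real i * d) / (?N n + real i * d) \<and> (?R n \<omega> + real i * d) / (?N n + real i * d) \<le> 1" for i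
    proof -
      have "0 \<le> real i * d"
        by simp
      then have "?R n \<omega> + real i * d \<le> ?N n + real i * d" "0 < ?N n + real i * d"
        using R_le[of \<omega> n] N_pos[of n] by linarith+
      then show ?thesis
        by (simp add: divide_le_eq_1_pos del: of_nat_add of_nat_mult)
    qed
    then have "0 \<le> g n \<omega> \<and> g n \<omega> \<le> 1"
      unfolding g_eq by (intro conjI prod_nonneg prod_le_1) auto
    then show ?thesis
      by simp
  qed
  have "(\<lambda>n. expectation (g n)) \<longlonglongrightarrow> expectation (\<lambda>\<omega>. ?L \<omega> ^ k)"
  proof (rule integral_dominated_convergence[where w="\<lambda>_. 1"])
    show "g n \<in> borel_measurable M" for n
      unfolding g_def
      by (rule borel_measurable_integrable, rule integrable_determined[where n=n])
         (rule red_balls_determined, simp)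
    show "AE \<omega> in M. (\<lambda>n. g n \<omega>) \<longlonglongrightarrow> ?L \<omega> ^ k"
      using AE_proportion_tendsto_limit
    proof eventually_elim
      case (elim \<omega>)
      have "(\<lambda>n. (?R n \<omega> + real i * d) / (?N n + real i * d)) \<longlonglongrightarrow> ?L \<omega>" for i
      proof -
        have 1: "(\<lambda>n. ?N n / (?N n + real i * d)) \<longlonglongrightarrow> 1" "(\<lambda>n. real i * d / (?N n + real i * d)) \<longlonglongrightarrow> 0"
          using params by real_asymp+
        have "(\<lambda>n. red_proportion r b d (\<lambda>k. X k \<omega>) n * (?N n / (?N n + real i * d)) + real i * d / (?N n + real i * d))
              \<longlonglongrightarrow> ?L \<omega> * 1 + 0"
          by (intro tendsto_add tendsto_mult elim 1)
        moreover have "red_proportion r b d (\<lambda>k. X k \<omega>) n * (?N n / (?N n + real i * d)) + real i * d / (?N n + real i * d)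
              = (?R n \<omega> + real i * d) / (?N n + real i * d)" for n
          using N_pos[of n] by (simp add: red_proportion_def add_divide_distrib del: of_nat_add of_nat_mult)
        ultimately show ?thesis
          by simp
      qed
      then have "(\<lambda>n. g n \<omega>) \<longlonglongrightarrow> (\<Prod>i<k. ?L \<omega>)"
        unfolding g_eq by (intro tendsto_prod)
      then show ?case
        by simp
    qed
  qed (use g_bound in auto)
  moreover have "expectation (g n) = rising d k r / rising d k (real r + real b)" for n
    unfolding g_def by (rule expectation_rising)
  ultimately show ?thesis
    by (simp add: LIMSEQ_const_iff)
qed

end

section \<open>The limit lies below the initial proportion with a uniform probability\<close>

lemma beta_variance:
  fixes a b d :: real
  assumes pos: "a > 0" "b > 0" "d > 0"
  defines "N \<equiv> a + b" and "m \<equiv> \<lambda>k. rising d k a / rising d k (a + b)"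
  shows "m 2 - 2 * (a / N) * m 1 + (a / N) ^ 2 = a * b * d / (N ^ 2 * (N + d))"
proof -
  have b: "b = N - a" and N: "N > 0" "N + d > 0"
    using pos by (auto simp: N_def)
  have "m 1 = a / N" "m 2 = a * (a + d) / (N * (N + d))"
    by (simp_all add: m_def N_def rising_def eval_nat_numeral lessThan_Suc mult_ac)
  moreover define D where "D = N ^ 2 * (N + d)"
  ultimately have terms: "m 2 = a * (a + d) * N / D" "2 * (a / N) * m 1 = 2 * a ^ 2 * (N + d) / D"
    "(a / N) ^ 2 = a ^ 2 * (N + d) / D"
    using N by (simp_all add: power2_eq_square)
  have "a * (a + d) * N - 2 * a ^ 2 * (N + d) + a ^ 2 * (N + d) = a * b * d"
    unfolding b by (simp add: eval_nat_numeral algebra_simps)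
  then show ?thesis
    unfolding terms D_def[symmetric] by (simp only: diff_divide_distrib[symmetric] add_divide_distrib[symmetric])
qed

text \<open>With \<open>\<alpha> = a / d\<close> and \<open>\<beta> = b / d\<close>, the right-hand side is the fourth central moment of the beta distribution with
parameters \<open>\<alpha>\<close> and \<open>\<beta>\<close>.\<close>

lemma beta_fourth_moment:
  fixes a b d :: real
  assumes pos: "a > 0" "b > 0" "d > 0"
  defines "N \<equiv> a + b" and "m \<equiv> \<lambda>k. rising d k a / rising d k (a + b)"
  shows "m 4 - 4 * (a / N) * m 3 + 6 * (a / N) ^ 2 * m 2 - 4 * (a / N) ^ 3 * m 1 + (a / N) ^ 4
           = 3 * d ^ 2 * a * b * (2 * d * N ^ 2 + a * b * (N - 6 * d)) / (N ^ 4 * (N + d) * (N + 2 * d) * (N + 3 * d))"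
proof -
  have b: "b = N - a" and N: "N > 0" "N + d > 0" "N + 2 * d > 0" "N + 3 * d > 0"
    using pos by (auto simp: N_def)
  have m: "m 1 = a / N" "m 2 = a * (a + d) / (N * (N + d))"
    "m 3 = a * (a + d) * (a + 2 * d) / (N * (N + d) * (N + 2 * d))"
    "m 4 = a * (a + d) * (a + 2 * d) * (a + 3 * d) / (N * (N + d) * (N + 2 * d) * (N + 3 * d))"
    by (simp_all add: m_def N_def rising_def eval_nat_numeral lessThan_Suc mult_ac)
  define D where "D = N ^ 4 * (N + d) * (N + 2 * d) * (N + 3 * d)"
  have terms: "m 4 = a * (a + d) * (a + 2 * d) * (a + 3 * d) * N ^ 3 / D"
    "4 * (a / N) * m 3 = 4 * a ^ 2 * (a + d) * (a + 2 * d) * N ^ 2 * (N + 3 * d) / D"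
    "6 * (a / N) ^ 2 * m 2 = 6 * a ^ 3 * (a + d) * N * (N + 2 * d) * (N + 3 * d) / D"
    "4 * (a / N) ^ 3 * m 1 = 4 * a ^ 4 * (N + d) * (N + 2 * d) * (N + 3 * d) / D"
    "(a / N) ^ 4 = a ^ 4 * (N + d) * (N + 2 * d) * (N + 3 * d) / D"
    unfolding m D_def using N
    by (simp_all add: power_divide, simp_all add: eval_nat_numeral mult_ac, simp_all add: algebra_simps)
  have "a * (a + d) * (a + 2 * d) * (a + 3 * d) * N ^ 3
      - 4 * a ^ 2 * (a + d) * (a + 2 * d) * N ^ 2 * (N + 3 * d)
      + 6 * a ^ 3 * (a + d) * N * (N + 2 * d) * (N + 3 * d)
      - 4 * a ^ 4 * (N + d) * (N + 2 * d) * (N + 3 * d)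
      + a ^ 4 * (N + d) * (N + 2 * d) * (N + 3 * d)
      = 3 * d ^ 2 * a * b * (2 * d * N ^ 2 + a * b * (N - 6 * d))"
    unfolding b by (simp add: eval_nat_numeral algebra_simps)
  then show ?thesis
    unfolding terms D_def[symmetric] by (simp only: diff_divide_distrib[symmetric] add_divide_distrib[symmetric])
qed

text \<open>The kurtosis is at most \<open>3 + 6 d N / (a b)\<close>, and \<open>N \<le> 2 a b\<close> for \<open>a, b \<ge> 1\<close>.  What matters is that the bound does
not depend on \<open>a\<close> and \<open>b\<close>, which are unbounded along the process.\<close>

lemma beta_kurtosis_le:
  fixes a b d :: real
  assumes "a \<ge> 1" "b \<ge> 1" "d \<ge> 1"
  defines "N \<equiv> a + b"
  shows "3 * d ^ 2 * a * b * (2 * d * N ^ 2 + a * b * (N - 6 * d)) / (N ^ 4 * (N + d) * (N + 2 * d) * (N + 3 * d))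
           \<le> 15 * d * (a * b * d / (N ^ 2 * (N + d))) ^ 2"
proof -
  define p where "p = a * b"
  have p: "p > 0" and N: "N > 0"
    using assms by (auto simp: p_def N_def)
  have "0 \<le> (a - 1) * b + a * (b - 1)"
    using assms by (intro add_nonneg_nonneg mult_nonneg_nonneg) auto
  then have Np: "N \<le> 2 * p"
    by (simp add: N_def p_def algebra_simps)
  have "2 * d * N ^ 2 + p * (N - 6 * d) \<le> 2 * d * N * (2 * p) + p * (N * d)"
  proof (intro add_mono mult_left_mono)
    show "2 * d * N ^ 2 \<le> 2 * d * N * (2 * p)"
      using Np N assms by (simp add: power2_eq_square)
    have "N * 1 \<le> N * d"
      using N assms by (intro mult_left_mono) auto
    then show "N - 6 * d \<le> N * d"
      using assms by linarith
  qed (use p in auto)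
  then have "3 * (2 * d * N ^ 2 + p * (N - 6 * d)) * (N + d) \<le> 3 * (5 * d * p * N) * (N + d)"
    using N assms by (intro mult_right_mono) (auto simp: algebra_simps)
  also have "\<dots> = 15 * d * p * (N * (N + d))"
    by (simp add: algebra_simps)
  also have "\<dots> \<le> 15 * d * p * ((N + 2 * d) * (N + 3 * d))"
    using N p assms by (intro mult_left_mono mult_mono) auto
  finally have le: "3 * (2 * d * N ^ 2 + p * (N - 6 * d)) * (N + d) \<le> 15 * d * p * ((N + 2 * d) * (N + 3 * d))" .
  have "3 * d ^ 2 * p * (2 * d * N ^ 2 + p * (N - 6 * d)) / (N ^ 4 * (N + d) * (N + 2 * d) * (N + 3 * d))
        = (3 * (2 * d * N ^ 2 + p * (N - 6 * d)) * (N + d)) * (d ^ 2 * p / (N ^ 4 * (N + d) ^ 2 * (N + 2 * d) * (N + 3 * d)))"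
    using N assms by (simp add: divide_simps power2_eq_square)
  also have "\<dots> \<le> 15 * d * p * ((N + 2 * d) * (N + 3 * d)) * (d ^ 2 * p / (N ^ 4 * (N + d) ^ 2 * (N + 2 * d) * (N + 3 * d)))"
    using N p assms by (intro mult_right_mono le) auto
  also have "\<dots> = 15 * d * (p * d / (N ^ 2 * (N + d))) ^ 2"
  proof -
    have "N + 2 * d \<noteq> 0" "N + 3 * d \<noteq> 0" "N + d \<noteq> 0"
      using N assms by linarith+
    then show ?thesis
      using N by (simp add: divide_simps eval_nat_numeral)
  qed
  finally show ?thesis
    by (simp add: p_def mult.assoc)
qed

context polya_urn
begin

lemma prob_limit_below_start:
  "prob {\<omega>\<in>space M. limit_proportion r b d (\<lambda>k. X k \<omega>) < r / real (r + b)} \<ge> 2 / (75 * real d)"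
proof -
  let ?L = "\<lambda>\<omega>. limit_proportion r b d (\<lambda>k. X k \<omega>)"
  define N where "N = real r + real b"
  define z where "z = r / N"
  define m where "m k = rising d k r / rising d k (real r + real b)" for k
  define v where "v = real r * b * d / (N ^ 2 * (N + d))"
  have pos: "real r \<ge> 1" "real b \<ge> 1" "real d \<ge> 1"
    using params by auto
  then have N: "N > 0"
    by (simp add: N_def)
  have int: "integrable M (\<lambda>\<omega>. ?L \<omega> ^ k)" for k
  proof (rule integrable_const_bound[where B=1])
    show "AE \<omega> in M. norm (?L \<omega> ^ k) \<le> 1"
      using limit_proportion_bounds by eventually_elim (simp add: power_abs power_le_one)
  qed simp
  have E: "expectation (\<lambda>\<omega>. ?L \<omega> ^ k) = m k" for k
    by (simp add: expectation_limit_power m_def)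
  have E1: "expectation ?L = m 1" and int1: "integrable M ?L"
    using E[of 1] int[of 1] by simp_all
  have sq: "(x - z) ^ 2 = x ^ 2 - 2 * z * x + z ^ 2" for x
    by (simp add: power2_eq_square algebra_simps)
  have fourth: "(x - z) ^ 4 = x ^ 4 - 4 * z * x ^ 3 + 6 * z ^ 2 * x ^ 2 - 4 * z ^ 3 * x + z ^ 4" for x
    by (simp add: eval_nat_numeral algebra_simps)
  have "2 / (5 * (15 * real d)) \<le> prob {\<omega>\<in>space M. ?L \<omega> - z < 0}"
  proof (rule prob_neg_ge_of_fourth_moment[where v=v])
    show "integrable M (\<lambda>\<omega>. ?L \<omega> - z)" "integrable M (\<lambda>\<omega>. (?L \<omega> - z) ^ 2)" "integrable M (\<lambda>\<omega>. (?L \<omega> - z) ^ 4)"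
      unfolding sq fourth using int int1 by auto
    show "expectation (\<lambda>\<omega>. ?L \<omega> - z) = 0"
      using int1 by (simp add: E1 prob_space m_def z_def N_def rising_def)
    have "expectation (\<lambda>\<omega>. (?L \<omega> - z) ^ 2) = m 2 - 2 * z * m 1 + z ^ 2"
      unfolding sq using int int1 by (simp add: E E1 prob_space)
    also have "\<dots> = v"
      unfolding m_def z_def v_def N_def by (rule beta_variance) (use pos in auto)
    finally show "expectation (\<lambda>\<omega>. (?L \<omega> - z) ^ 2) = v" .
    have "expectation (\<lambda>\<omega>. (?L \<omega> - z) ^ 4)
          = m 4 - 4 * z * m 3 + 6 * z ^ 2 * m 2 - 4 * z ^ 3 * m 1 + z ^ 4"
      unfolding fourth using int int1 by (simp add: E E1 prob_space)
    also have "\<dots> = 3 * real d ^ 2 * r * b * (2 * real d * N ^ 2 + real r * b * (N - 6 * real d))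
                      / (N ^ 4 * (N + d) * (N + 2 * real d) * (N + 3 * real d))"
      unfolding m_def z_def N_def by (rule beta_fourth_moment) (use pos in auto)
    also have "\<dots> \<le> 15 * real d * v ^ 2"
      unfolding v_def N_def by (rule beta_kurtosis_le) (use pos in auto)
    finally show "expectation (\<lambda>\<omega>. (?L \<omega> - z) ^ 4) \<le> 15 * real d * v ^ 2" .
    show "v > 0"
      using pos N by (simp add: v_def)
  qed (use pos in auto)
  then show ?thesis
    by (simp add: z_def N_def)
qed

section \<open>Restarting the urn after a history\<close>

text \<open>The Markov property: a history of the restarted urn, conditioned on \<open>h\<close>, is the concatenation \<open>f\<close> of the
two histories, and the composition of the urn depends only on this concatenation.\<close>

lemma polya_urn_restart:
  "polya_urn (uniform_measure M (history n h)) (red_balls r d h n)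
     (n * d + r + b - red_balls r d h n) d (\<lambda>k. X (n + k))"
proof -
  let ?H = "history n h"
  let ?M = "uniform_measure M ?H"
  have H: "emeasure M ?H \<noteq> 0" "emeasure M ?H \<noteq> \<infinity>"
    using prob_history_pos[of n h] by (auto simp: emeasure_eq_measure)
  interpret U: prob_space ?M
    by (rule prob_space_uniform_measure[OF H])
  show ?thesis
  proof unfold_locales
    show "red_balls r d h n \<ge> 1" "n * d + r + b - red_balls r d h n \<ge> 1" "d \<ge> 1"
      using params red_balls_bounds[of r d h n] by linarith+
    show "X (n + m) \<in> measurable ?M (count_space UNIV)" for m
      by simp
    fix m :: nat and g :: "nat \<Rightarrow> bool"
    define f where "f k = (if k < n then h k else g (k - n))" for k
    have all_f: "(\<forall>k<n + m. X k \<omega> = f k) \<longleftrightarrow> (\<forall>k<n. X k \<omega> = h k) \<and> (\<forall>k<m. X (n + k) \<omega> = g k)" for \<omega>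
    proof (rule iffI; intro conjI allI impI)
      fix k assume *: "\<forall>k<n + m. X k \<omega> = f k"
      show "X k \<omega> = h k" if "k < n" 
        using *[rule_format, of k] that by (simp add: f_def)
      show "X (n + k) \<omega> = g k" if "k < m" 
        using *[rule_format, of "n + k"] that by (simp add: f_def)
    next
      fix k assume *: "(\<forall>k<n. X k \<omega> = h k) \<and> (\<forall>k<m. X (n + k) \<omega> = g k)" and "k < n + m"
      show "X k \<omega> = f k"
      proof (cases "k < n")
        case False
        with \<open>k < n + m\<close> * have "X (n + (k - n)) \<omega> = g (k - n)"
          by (intro *[THEN conjunct2, rule_format]) simp
        with False show ?thesis
          by (simp add: f_def)
      qed (use * in \<open>simp add: f_def\<close>)
    qed
    have red_f: "red_balls r d f (n + m) = red_balls (red_balls r d h n) d g m"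
    proof -
      have "red_balls r d f n = red_balls r d h n"
        by (rule determined_by_firstD[OF red_balls_determined[of n n "\<lambda>a. a" r d]]) (auto simp: f_def)
      then show ?thesis
        by (simp add: red_balls_shift f_def)
    qed
    have total: "(n + m) * d + r + b = m * d + red_balls r d h n + (n * d + r + b - red_balls r d h n)"
      using red_balls_bounds(2)[of r d h n] by (simp add: algebra_simps)
    have U: "measure ?M {\<omega>\<in>space M. P \<omega>} = prob {\<omega>\<in>space M. P \<omega> \<and> (\<forall>k<n. X k \<omega> = h k)} / prob ?H"
      if "{\<omega>\<in>space M. P \<omega>} \<in> sets M" for P
    proof -
      have "?H \<inter> {\<omega>\<in>space M. P \<omega>} = {\<omega>\<in>space M. P \<omega> \<and> (\<forall>k<n. X k \<omega> = h k)}"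
        by (auto simp: history_def)
      then show ?thesis
        using that H by simp
    qed
    have "\<P>(\<omega> in ?M. X (n + m) \<omega> \<bar> \<forall>k<m. X (n + k) \<omega> = g k)
          = \<P>(\<omega> in M. X (n + m) \<omega> \<bar> \<forall>k<n + m. X k \<omega> = f k)"
      unfolding cond_prob_def all_f space_uniform_measure
      using prob_history_pos[of n h] by (simp add: U conj_ac)
    also have "\<dots> = red_balls r d f (n + m) / real ((n + m) * d + r + b)"
      by (rule prob_red_draw)
    finally show "\<P>(\<omega> in ?M. X (n + m) \<omega> \<bar> \<forall>k<m. X (n + k) \<omega> = g k)
        = real (red_balls (red_balls r d h n) d g m)
          / real (m * d + red_balls r d h n + (n * d + r + b - red_balls r d h n))"
      by (simp only: red_f total)
  qed
qed

lemma prob_history_limit_below: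
  "prob (history n h \<inter> {\<omega>\<in>space M. limit_proportion r b d (\<lambda>k. X k \<omega>) < red_proportion r b d (\<lambda>k. X k \<omega>) n})
     \<ge> 2 / (75 * real d) * prob (history n h)"
proof -
  let ?H = "history n h"
  let ?B = "{\<omega>\<in>space M. limit_proportion r b d (\<lambda>k. X k \<omega>) < red_proportion r b d (\<lambda>k. X k \<omega>) n}"
  let ?r = "red_balls r d h n" and ?b = "n * d + r + b - red_balls r d h n"
  let ?A = "{\<omega>\<in>space M. limit_proportion ?r ?b d (\<lambda>k. X (n + k) \<omega>) < ?r / real (?r + ?b)}"
  interpret U: polya_urn "uniform_measure M ?H" ?r ?b d "\<lambda>k. X (n + k)"
    by (rule polya_urn_restart)
  have H: "emeasure M ?H \<noteq> 0" "emeasure M ?H \<noteq> \<infinity>"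
    using prob_history_pos[of n h] by (auto simp: emeasure_eq_measure)
  have [measurable]: "(\<lambda>\<omega>. limit_proportion ?r ?b d (\<lambda>k. X (n + k) \<omega>)) \<in> borel_measurable M"
    by (rule limit_proportion_measurable[OF random_draw])
  have A: "?A \<in> sets M"
    by measurable
  have "?H \<inter> ?A = ?H \<inter> ?B"
  proof -
    have "\<omega> \<in> ?A \<longleftrightarrow> \<omega> \<in> ?B" if "\<omega> \<in> ?H" for \<omega>
    proof -
      have "red_balls r d (\<lambda>k. X k \<omega>) n = ?r"
        using that by (intro determined_by_firstD[OF red_balls_determined[of n n "\<lambda>a. a" r d]]) (auto simp: history_def)
      then show ?thesis
        using limit_proportion_shift[of r d "\<lambda>k. X k \<omega>" n b] red_balls_bounds(2)[of r d h n]
        by (simp add: red_proportion_def)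
    qed
    then show ?thesis
      by blast
  qed
  then have "prob (?H \<inter> ?B) / prob ?H \<ge> 2 / (75 * real d)"
    using U.prob_limit_below_start A H by simp
  then show ?thesis
    using prob_history_pos[of n h] by (simp add: pos_le_divide_eq)
qed

section \<open>The zero-one argument\<close>

definition cylinders :: "'a set set" where
  "cylinders = {{\<omega>\<in>space M. P (\<lambda>k. X k \<omega>)} |n P. determined_by_first n P}"

lemma cylindersI: "determined_by_first n P \<Longrightarrow> {\<omega>\<in>space M. P (\<lambda>k. X k \<omega>)} \<in> cylinders"
  unfolding cylinders_def by blast

lemma cylinders_algebra: "algebra (space M) cylinders"
  unfolding algebra_iff_Un
proof (intro conjI ballI)
  show "cylinders \<subseteq> Pow (space M)"
    by (auto simp: cylinders_def)
  show "{} \<in> cylinders"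
    using cylindersI[of 0 "\<lambda>_. False"] by (simp add: determined_by_first_def)
  show "space M - C \<in> cylinders" if C: "C \<in> cylinders" for C
  proof -
    obtain n P where P: "determined_by_first n P" "C = {\<omega>\<in>space M. P (\<lambda>k. X k \<omega>)}"
      using C by (auto simp: cylinders_def)
    then have "determined_by_first n (\<lambda>x. \<not> P x)"
      unfolding determined_by_first_def by blast
    from cylindersI[OF this] have "{\<omega>\<in>space M. \<not> P (\<lambda>k. X k \<omega>)} \<in> cylinders" .
    moreover have "space M - C = {\<omega>\<in>space M. \<not> P (\<lambda>k. X k \<omega>)}"
      using P by auto
    ultimately show ?thesis
      by simp
  qed
  show "C \<union> D \<in> cylinders" if C: "C \<in> cylinders" and D: "D \<in> cylinders" for C D
  proof -
    obtain n P where P: "determined_by_first n P" "C = {\<omega>\<in>space M. P (\<lambda>k. X k \<omega>)}"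
      using C by (auto simp: cylinders_def)
    obtain m Q where Q: "determined_by_first m Q" "D = {\<omega>\<in>space M. Q (\<lambda>k. X k \<omega>)}"
      using D by (auto simp: cylinders_def)
    have "determined_by_first (max n m) P" "determined_by_first (max n m) Q"
      using P Q by (auto intro: determined_by_first_mono)
    then have "determined_by_first (max n m) (\<lambda>x. P x \<or> Q x)"
      unfolding determined_by_first_def by blast
    from cylindersI[OF this] have "{\<omega>\<in>space M. P (\<lambda>k. X k \<omega>) \<or> Q (\<lambda>k. X k \<omega>)} \<in> cylinders" .
    moreover have "C \<union> D = {\<omega>\<in>space M. P (\<lambda>k. X k \<omega>) \<or> Q (\<lambda>k. X k \<omega>)}"
      using P Q by auto
    ultimately show ?thesis
      by simp
  qed
qed

lemma cylinder_eq_Union_histories: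
  assumes "determined_by_first n P"
  shows "{\<omega>\<in>space M. P (\<lambda>k. X k \<omega>)} = (\<Union>S\<in>{S\<in>Pow {..<n}. P (\<lambda>k. k \<in> S)}. history n (\<lambda>k. k \<in> S))"
proof (intro equalityI subsetI)
  fix \<omega> assume \<omega>: "\<omega> \<in> {\<omega>\<in>space M. P (\<lambda>k. X k \<omega>)}"
  let ?S = "{k. k < n \<and> X k \<omega>}"
  have "P (\<lambda>k. k \<in> ?S) = P (\<lambda>k. X k \<omega>)"
    by (rule determined_by_firstD[OF assms]) simp
  with \<omega> show "\<omega> \<in> (\<Union>S\<in>{S\<in>Pow {..<n}. P (\<lambda>k. k \<in> S)}. history n (\<lambda>k. k \<in> S))"
    by (intro UN_I[of ?S]) (auto simp: history_def)
next
  fix \<omega> assume "\<omega> \<in> (\<Union>S\<in>{S\<in>Pow {..<n}. P (\<lambda>k. k \<in> S)}. history n (\<lambda>k. k \<in> S))"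
  then obtain S where S: "P (\<lambda>k. k \<in> S)" "\<omega> \<in> history n (\<lambda>k. k \<in> S)"
    by auto
  have "P (\<lambda>k. X k \<omega>) = P (\<lambda>k. k \<in> S)"
    by (rule determined_by_firstD[OF assms]) (use S in \<open>auto simp: history_def\<close>)
  then show "\<omega> \<in> {\<omega>\<in>space M. P (\<lambda>k. X k \<omega>)}"
    using S by (auto simp: history_def)
qed

lemma cylinders_measurable: "cylinders \<subseteq> sets M"
  by (auto simp: cylinders_def cylinder_eq_Union_histories intro!: sets.finite_UN)

lemma prob_cylinder_Int:
  assumes P: "determined_by_first n P" and B: "B \<in> sets M"
  shows "prob ({\<omega>\<in>space M. P (\<lambda>k. X k \<omega>)} \<inter> B)
           = (\<Sum>S\<in>{S\<in>Pow {..<n}. P (\<lambda>k. k \<in> S)}. prob (history n (\<lambda>k. k \<in> S) \<inter> B))"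
proof -
  have "disjoint_family_on (\<lambda>S. history n (\<lambda>k. k \<in> S) \<inter> B) (Pow {..<n})"
    by (auto simp: disjoint_family_on_def history_def)
  then have "disjoint_family_on (\<lambda>S. history n (\<lambda>k. k \<in> S) \<inter> B) {S\<in>Pow {..<n}. P (\<lambda>k. k \<in> S)}"
    by (rule disjoint_family_on_mono[rotated]) auto
  then have "prob (\<Union>S\<in>{S\<in>Pow {..<n}. P (\<lambda>k. k \<in> S)}. history n (\<lambda>k. k \<in> S) \<inter> B)
           = (\<Sum>S\<in>{S\<in>Pow {..<n}. P (\<lambda>k. k \<in> S)}. prob (history n (\<lambda>k. k \<in> S) \<inter> B))"
    by (intro finite_measure_finite_Union) (use B in auto)
  then show ?thesis
    unfolding cylinder_eq_Union_histories[OF P] by (simp add: Int_UN_distrib2)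
qed

definition limit_exceeded :: "'a set" where
  "limit_exceeded = {\<omega>\<in>space M. \<exists>n\<ge>1. limit_proportion r b d (\<lambda>k. X k \<omega>) < red_proportion r b d (\<lambda>k. X k \<omega>) n}"

lemma limit_exceeded_measurable [measurable]: "limit_exceeded \<in> sets M"
  unfolding limit_exceeded_def by measurable

text \<open>All draws are measurable for the sigma-algebra generated by the cylinders, hence so are the proportions and
their limit.\<close>

lemma limit_exceeded_in_sigma_sets: "limit_exceeded \<in> sigma_sets (space M) cylinders"
proof -
  define N where "N = sigma (space M) cylinders"
  have sub: "cylinders \<subseteq> Pow (space M)"
    by (auto simp: cylinders_def)
  then have sets_N: "sets N = sigma_sets (space M) cylinders" and space_N: "space N = space M"
    by (simp_all add: N_def)
  have X [measurable]: "X k \<in> measurable N (count_space UNIV)" for k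
  proof -
    have "determined_by_first (Suc k) (\<lambda>x. x k)"
      by (auto simp: determined_by_first_def)
    then have "{\<omega>\<in>space M. X k \<omega>} \<in> cylinders"
      by (rule cylindersI)
    then show ?thesis
      unfolding pred_def sets_N space_N by (rule sigma_sets.Basic)
  qed
  note [measurable] = red_proportion_measurable[OF X] limit_proportion_measurable[OF X]
  have "{\<omega>\<in>space N. \<exists>n\<ge>1. limit_proportion r b d (\<lambda>k. X k \<omega>) < red_proportion r b d (\<lambda>k. X k \<omega>) n} \<in> sets N"
    by measurable
  then show ?thesis
    by (simp add: limit_exceeded_def sets_N space_N)
qed

text \<open>A cylinder splits into histories of a common length, and after each of them the current proportion exceeds
the limit with the uniform probability.\<close>

lemma prob_cylinder_limit_exceeded:
  assumes "C \<in> cylinders"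
  shows "prob (C \<inter> limit_exceeded) \<ge> 2 / (75 * real d) * prob C"
proof -
  obtain n P where P: "determined_by_first n P" and C: "C = {\<omega>\<in>space M. P (\<lambda>k. X k \<omega>)}"
    using assms by (auto simp: cylinders_def)
  \<comment> \<open>Positive length, because \<open>limit_exceeded\<close> leaves out the proportion at time \<open>0\<close>.\<close>
  from P have P': "determined_by_first (Suc n) P"
    by (rule determined_by_first_mono) simp
  let ?I = "{S\<in>Pow {..<Suc n}. P (\<lambda>k. k \<in> S)}"
  have "2 / (75 * real d) * prob C = (\<Sum>S\<in>?I. 2 / (75 * real d) * prob (history (Suc n) (\<lambda>k. k \<in> S)))"
    using prob_cylinder_Int[OF P' sets.top] by (simp add: C Int_absorb2 history_def sum_distrib_left)
  also have "\<dots> \<le> (\<Sum>S\<in>?I. prob (history (Suc n) (\<lambda>k. k \<in> S) \<inter> limit_exceeded))"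
  proof (rule sum_mono)
    fix S
    note prob_history_limit_below[of "Suc n" "\<lambda>k. k \<in> S"]
    also have "prob (history (Suc n) (\<lambda>k. k \<in> S) \<inter> {\<omega>\<in>space M. limit_proportion r b d (\<lambda>k. X k \<omega>) < red_proportion r b d (\<lambda>k. X k \<omega>) (Suc n)})
        \<le> prob (history (Suc n) (\<lambda>k. k \<in> S) \<inter> limit_exceeded)"
      by (intro finite_measure_mono) (auto simp: limit_exceeded_def intro!: exI[of _ "Suc n"])
    finally show "2 / (75 * real d) * prob (history (Suc n) (\<lambda>k. k \<in> S)) \<le> prob (history (Suc n) (\<lambda>k. k \<in> S) \<inter> limit_exceeded)" .
  qed
  also have "\<dots> = prob (C \<inter> limit_exceeded)"
    unfolding C by (rule prob_cylinder_Int[OF P' limit_exceeded_measurable, symmetric])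
  finally show ?thesis .
qed

text \<open>Let \<open>C\<close> be a cylinder that differs from the complement \<open>E\<close> of \<open>limit_exceeded\<close> by an event of probability \<open>e\<close>.
Then \<open>C\<close> contains at most \<open>e\<close> of \<open>limit_exceeded\<close>, but at least \<open>\<delta> P(C) \<ge> \<delta> (P(E) - e)\<close>; for small \<open>e\<close> this
forces \<open>P(E) = 0\<close>.\<close>

lemma AE_limit_exceeded: "AE \<omega> in M. \<omega> \<in> limit_exceeded"
proof -
  define \<delta> where "\<delta> = 2 / (75 * real d)"
  have \<delta>: "\<delta> > 0"
    using params by (simp add: \<delta>_def)
  let ?E = "space M - limit_exceeded"
  have "prob ?E \<le> 0"
  proof (rule ccontr)
    assume "\<not> prob ?E \<le> 0"
    then have "\<delta> * prob ?E / (1 + \<delta>) > 0"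
      using \<delta> by simp
    moreover have "?E \<in> sigma_sets (space M) cylinders"
      by (intro sigma_sets.Compl limit_exceeded_in_sigma_sets)
    ultimately obtain C where C: "C \<in> cylinders" and close: "prob (sym_diff ?E C) < \<delta> * prob ?E / (1 + \<delta>)"
      using algebra_approximates_sigma_sets[OF cylinders_algebra cylinders_measurable] by blast
    have C_sets: "C \<in> sets M"
      using C cylinders_measurable by blast
    let ?e = "prob (sym_diff ?E C)"
    have "prob ?E \<le> prob (C \<union> sym_diff ?E C)"
      by (rule finite_measure_mono) (use C_sets in auto)
    also have "\<dots> \<le> prob C + ?e"
      by (rule measure_subadditive) (use C_sets in auto)
    finally have "\<delta> * prob ?E \<le> \<delta> * prob C + \<delta> * ?e"
      using \<delta> by (simp flip: distrib_left)
    also have "\<delta> * prob C \<le> prob (C \<inter> limit_exceeded)"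
      unfolding \<delta>_def by (rule prob_cylinder_limit_exceeded[OF C])
    also have "\<dots> \<le> ?e"
      by (rule finite_measure_mono) (use C_sets in auto)
    finally show False
      using close \<delta> by (simp add: field_simps)
  qed
  then have "prob ?E = 0"
    using measure_nonneg[of M ?E] by linarith
  then have "AE \<omega> in M. \<omega> \<notin> ?E"
    using prob_eq_0[of ?E] by simp
  then show ?thesis
    by (rule AE_mp) (auto intro!: AE_I2)
qed

end

theorem proposition3p3:
  fixes M :: "'a measure" and r b d :: nat and X :: "nat \<Rightarrow> 'a \<Rightarrow> bool"
    and Z :: "nat \<Rightarrow> 'a \<Rightarrow> real" and M_rb :: "'a \<Rightarrow> real"
  assumes "polya_urn M r b d X"
  defines "Z \<equiv> \<lambda>n \<omega>. red_proportion r b d (\<lambda>k. X k \<omega>) n"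
    and "M_rb \<equiv> \<lambda>\<omega>. max_proportion r b d (\<lambda>k. X k \<omega>)"
  shows "(AE \<omega> in M. \<exists>n\<ge>1. Z n \<omega> = M_rb \<omega>)
    \<and> \<P>(\<omega> in M. M_rb \<omega> \<in> \<rat>) = 1"
proof -
  interpret polya_urn M r b d X by fact
  have attained: "AE \<omega> in M. \<exists>n\<ge>1. Z n \<omega> = M_rb \<omega>"
    using AE_limit_exceeded AE_proportion_tendsto_limit
  proof eventually_elim
    case (elim \<omega>)
    then show ?case
      unfolding Z_def M_rb_def max_proportion_def limit_exceeded_def
      by (blast intro: SUP_attained_if_limit_exceeded)
  qed
  have "AE \<omega> in M. M_rb \<omega> \<in> \<rat>"
    using attained
  proof eventually_elim
    case (elim \<omega>)
    then obtain n where "M_rb \<omega> = red_proportion r b d (\<lambda>k. X k \<omega>) n"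
      unfolding Z_def by metis
    then show ?case
      by (simp add: red_proportion_def)
  qed
  have "M_rb \<in> borel_measurable M"
    unfolding M_rb_def max_proportion_def
    by (intro borel_measurable_cSUP)
       (auto intro!: bdd_aboveI[of _ 1] red_proportion_measurable red_proportion_bounds random_draw)
  moreover have "(\<rat> :: real set) \<in> sets borel"
    by (rule sets.countable[OF _ countable_rat]) simp
  ultimately have "M_rb -` \<rat> \<inter> space M \<in> sets M"
    by (intro measurable_sets)
  then have "{\<omega>\<in>space M. M_rb \<omega> \<in> \<rat>} \<in> sets M"
    by (simp add: vimage_def Int_def conj_commute)
  with \<open>AE \<omega> in M. M_rb \<omega> \<in> \<rat>\<close> show ?thesis
    using attained prob_Collect_eq_1[of "\<lambda>\<omega>. M_rb \<omega> \<in> \<rat>"] by blast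
qed

end
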